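(* For all $n\geq 2$, the Kähler manifold $(M,\omega)$, where $M=\tfrac12 D_a\oplus i\mathbb{R}^n\subset\mathbb{C}^n$ carries Calabi's inhomogeneous Kähler–Einstein form $\omega$, is globally symplectomorphic to $(\mathbb{R}^{2n},\omega_0)$ via the map $$\Phi:M\to\mathbb{R}^n\oplus i\mathbb{R}^n\simeq\mathbb{R}^{2n},\qquad (x,y)\mapsto(\operatorname{grad} f,\,y),$$ where $f:D_a\to\mathbb{R}$, $x=(x_1,\dots,x_n)\mapsto f(x)$, is a Kähler potential for $\omega$, i.e. $\omega=\frac{i}{2}\partial\bar\partial f$, and $\operatorname{grad} f=\left(\frac{\partial f}{\partial x_1},\dots,\frac{\partial f}{\partial x_n}\right)$. That is, $\Phi$ is a global diffeomorphism from $M$ onto $\mathbb{R}^{2n}$ and $\Phi^*\omega_0=\omega$.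
   Context: $D_a\subset\mathbb{R}^n$ is the open ball centered at the origin of radius $a$, and $M=\tfrac12 D_a\oplus i\mathbb{R}^n\subset\mathbb{C}^n$ is the corresponding complex tubular domain, with complex coordinates $z_j$, $x_j=(z_j+\bar z_j)/2$ and $y_j=(z_j-\bar z_j)/2i$. The form $\omega$ on $M$ is the Kähler form of the metric $g$ given by $$\omega=\frac{i}{2}\,\partial\bar\partial f(z_1+\bar z_1,\dots,z_n+\bar z_n),$$ where $f:D_a\to\mathbb{R}$ is a radial function $f(x_1,\dots,x_n)=Y(r)$, $r=\left(\sum_{j=1}^n x_j^2\right)^{1/2}$, satisfying the differential equation $$\left(\frac{Y'}{r}\right)^{n-1}Y''=e^{Y}$$ with initial conditions $Y'(0)=0$, $Y''(0)=e^{Y(0)/n}$. The radius $a$ is that of Calabi's construction, for which $Y'(r)\to\infty$ as $r\to a$. Calabi proved that the Kähler metric $g$ so defined is smooth, Einstein, complete and not locally homogeneous. $\omega_0=\sum_{j=1}^n dx_j\wedge dy_j$ is the standard symplectic form on $\mathbb{R}^{2n}$.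
   Formalization: As stated, with grad f taken at z+z̄=2x, Φ*ω₀ equals 2ω, not ω, a factor 2 slip. What is proved: (x,y)↦(½ grad f, y) is a global symplectomorphism from (M,ω) onto (R^{2n},ω₀), and Φ=(grad f, y) itself is a global diffeomorphism with Φ*ω₀=2ω. *)

theory Defs
  imports "HOL-Analysis.Analysis"
begin

section \<open>Smooth maps and diffeomorphisms\<close>

text \<open>On an open subset of a Euclidean space this is the usual class \<open>C\<^sup>k\<close>: all directional
  derivatives of order at most \<open>k\<close> exist (as Frechet derivatives) and are continuous.\<close>

primrec Ck_on :: "nat \<Rightarrow> 'a::real_normed_vector set \<Rightarrow> ('a \<Rightarrow> 'b::real_normed_vector) \<Rightarrow> bool" where
  "Ck_on 0 S f \<longleftrightarrow> continuous_on S f"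
| "Ck_on (Suc k) S f \<longleftrightarrow>
     (\<forall>x\<in>S. f differentiable (at x)) \<and> (\<forall>v. Ck_on k S (\<lambda>x. frechet_derivative f (at x) v))"

definition smooth_on :: "'a::real_normed_vector set \<Rightarrow> ('a \<Rightarrow> 'b::real_normed_vector) \<Rightarrow> bool" where
  "smooth_on S f \<longleftrightarrow> (\<forall>k. Ck_on k S f)"

definition diffeomorphism ::
    "'a::real_normed_vector set \<Rightarrow> 'b::real_normed_vector set \<Rightarrow> ('a \<Rightarrow> 'b) \<Rightarrow> bool" where
  "diffeomorphism M N \<Phi> \<longleftrightarrow>
     open M \<and> open N \<and> bij_betw \<Phi> M N \<and> smooth_on M \<Phi> \<and> smooth_on N (inv_into M \<Phi>)"


section \<open>Complex-valued differential 2-forms\<close>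

type_synonym 'a two_form = "'a \<Rightarrow> 'a \<Rightarrow> 'a \<Rightarrow> complex"

definition wedge :: "('a \<Rightarrow> complex) \<Rightarrow> ('a \<Rightarrow> complex) \<Rightarrow> 'a \<Rightarrow> 'a \<Rightarrow> complex" where
  "wedge \<alpha> \<beta> u v = \<alpha> u * \<beta> v - \<alpha> v * \<beta> u"

definition pullback ::
    "('a::real_normed_vector \<Rightarrow> 'b::real_normed_vector) \<Rightarrow> 'b two_form \<Rightarrow> 'a two_form" where
  "pullback \<Phi> \<sigma> p u v =
     \<sigma> (\<Phi> p) (frechet_derivative \<Phi> (at p) u) (frechet_derivative \<Phi> (at p) v)"

definition symplectomorphism ::
    "'a::real_normed_vector set \<Rightarrow> 'a two_form \<Rightarrow>
     'b::real_normed_vector set \<Rightarrow> 'b two_form \<Rightarrow> ('a \<Rightarrow> 'b) \<Rightarrow> bool" where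
  "symplectomorphism M \<omega> N \<sigma> \<Phi> \<longleftrightarrow>
     diffeomorphism M N \<Phi> \<and> (\<forall>p\<in>M. \<forall>u v. pullback \<Phi> \<sigma> p u v = \<omega> p u v)"

text \<open>The form \<open>\<Sum>\<^sub>j dx\<^sub>j \<and> dy\<^sub>j\<close>, with \<open>\<real>\<^sup>2\<^sup>n\<close> presented as the pairs \<open>(x, y)\<close>.\<close>

definition std_symplectic :: "((real^'n) \<times> (real^'n)) two_form" where
  "std_symplectic p u v =
     (\<Sum>j\<in>UNIV. wedge (\<lambda>w. complex_of_real (fst w $ j)) (\<lambda>w. complex_of_real (snd w $ j)) u v)"


section \<open>The operator \<open>\<partial>\<partial>-bar\<close> on \<open>\<complex>\<^sup>n\<close>\<close>

definition d_z :: "'n \<Rightarrow> (complex^'n \<Rightarrow> complex) \<Rightarrow> complex^'n \<Rightarrow> complex" where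
  "d_z j F z = (frechet_derivative F (at z) (axis j 1)
                 - \<i> * frechet_derivative F (at z) (axis j \<i>)) / 2"

definition d_zbar :: "'n \<Rightarrow> (complex^'n \<Rightarrow> complex) \<Rightarrow> complex^'n \<Rightarrow> complex" where
  "d_zbar j F z = (frechet_derivative F (at z) (axis j 1)
                    + \<i> * frechet_derivative F (at z) (axis j \<i>)) / 2"

definition ddbar :: "(complex^'n \<Rightarrow> complex) \<Rightarrow> (complex^'n) two_form" where
  "ddbar F z u v =
     (\<Sum>j\<in>UNIV. \<Sum>k\<in>UNIV. d_z j (d_zbar k F) z * wedge (\<lambda>w. w $ j) (\<lambda>w. cnj (w $ k)) u v)"


section \<open>Calabi's domain, form and gradient map\<close>

definition tube_domain :: "real \<Rightarrow> (complex^'n) set" where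
  "tube_domain a = {(\<chi> j. Complex (x $ j / 2) (y $ j)) | x y. x \<in> ball 0 a}"

definition add_conj :: "complex^'n \<Rightarrow> real^'n" where
  "add_conj z = (\<chi> j. Re (z $ j + cnj (z $ j)))"

definition calabi_form :: "(real^'n \<Rightarrow> real) \<Rightarrow> (complex^'n) two_form" where
  "calabi_form f z u v = (\<i> / 2) * ddbar (\<lambda>w. complex_of_real (f (add_conj w))) z u v"

definition grad :: "(real^'n \<Rightarrow> real) \<Rightarrow> real^'n \<Rightarrow> real^'n" where
  "grad f x = (\<chi> j. frechet_derivative f (at x) (axis j 1))"

text \<open>The map \<open>(x, y) \<mapsto> (c grad f, y)\<close>. The gradient is taken on the domain of \<open>f\<close>, i.e. at the
  point \<open>z + z-bar = 2x\<close> of the ball of radius \<open>a\<close>. The constant \<open>c\<close> accounts for the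
  chain rule: with \<open>f\<^sub>j\<^sub>k\<close> the second partial derivatives of \<open>f\<close>,
  \<open>(i/2) \<partial>\<partial>-bar (f (z + z-bar)) = \<Sum>\<^sub>j\<^sub>k f\<^sub>j\<^sub>k(2x) dx\<^sub>j \<and> dy\<^sub>k\<close>, whereas the pullback of
  \<open>\<Sum>\<^sub>j dx\<^sub>j \<and> dy\<^sub>j\<close> is \<open>2c \<Sum>\<^sub>j\<^sub>k f\<^sub>j\<^sub>k(2x) dx\<^sub>j \<and> dy\<^sub>k\<close>. So \<open>c = 1/2\<close> gives the form itself, and
  \<open>c = 1\<close> gives twice the form.\<close>

definition grad_map :: "real \<Rightarrow> (real^'n \<Rightarrow> real) \<Rightarrow> complex^'n \<Rightarrow> (real^'n) \<times> (real^'n)" where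
  "grad_map c f z = (c *\<^sub>R grad f (add_conj z), (\<chi> j. Im (z $ j)))"

end

theory Submission
  imports Defs
begin

text \<open>
  Write \<open>slope r = Y' r / r\<close>, so that \<open>grad f x = slope |x| *\<^sub>R x\<close>. The ODE integrates to
  \<open>slope |x| ^ n = n * \<integral>\<^sub>0\<^sup>1 t ^ (n - 1) * exp (f (t x)) dt\<close>. Hence if \<open>f\<close> is
  \<open>C\<^sup>k\<close> on the ball, so are \<open>slope |x|\<close> and \<open>grad f\<close>, and \<open>f\<close> is of class
  \<open>C\<^sup>k\<^sup>+\<^sup>1\<close>: the solution is smooth across the singular point of the ODE.
  Since \<open>Y'\<close> increases from 0 to infinity on \<open>[0, a)\<close>, \<open>grad f\<close> is a bijection from the
  ball onto \<open>\<real>\<^sup>n\<close>. Its inverse \<open>H\<close> is continuous by invariance of domain and satisfies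
  \<open>DH = (Hess f)\<inverse> \<circ> H\<close> with an explicit inverse Hessian, which bootstraps its smoothness.
  The identity of the 2-forms is the symmetry of the Hessian.
\<close>

section \<open>Calculus of \<open>C\<^sup>k\<close> maps\<close>

lemma frechet_derivativeI:
  "(f has_derivative f') (at x) \<Longrightarrow> frechet_derivative f (at x) = f'"
  using frechet_derivative_at by metis

text \<open>Being a derivative at a point depends only on the germ, and
  \<open>frechet_derivative\<close> is a choice among the derivatives, so the choices agree even
  where none exists.\<close>

lemma frechet_derivative_cong_open:
  assumes "open S" "x \<in> S" "\<And>y. y \<in> S \<Longrightarrow> f y = g y"
  shows "frechet_derivative f (at x) = frechet_derivative g (at x)"
proof -
  have "(f has_derivative D) (at x) \<longleftrightarrow> (g has_derivative D) (at x)" for D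
    using assms has_derivative_transform_within_open[of _ D x UNIV S] by metis
  then show ?thesis by (simp add: frechet_derivative_def)
qed

lemma Ck_on_cong:
  assumes "open S" "\<And>x. x \<in> S \<Longrightarrow> f x = g x"
  shows "Ck_on k S f \<longleftrightarrow> Ck_on k S g"
  using assms(2)
proof (induction k arbitrary: f g)
  case 0
  then show ?case by (simp cong: continuous_on_cong)
next
  case (Suc k)
  have 1: "frechet_derivative f (at x) = frechet_derivative g (at x)" if "x \<in> S" for x
    using frechet_derivative_cong_open[OF assms(1) that] Suc.prems by blast
  have "f differentiable (at x) \<longleftrightarrow> g differentiable (at x)" if "x \<in> S" for x
    unfolding differentiable_def
    using Suc.prems assms(1) has_derivative_transform_within_open[of _ _ x UNIV S] that by metis
  moreover have "Ck_on k S (\<lambda>x. frechet_derivative f (at x) v)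
      \<longleftrightarrow> Ck_on k S (\<lambda>x. frechet_derivative g (at x) v)" for v
    by (rule Suc.IH) (simp add: 1)
  ultimately show ?case by simp
qed

text \<open>Lets an explicit formula \<open>f'\<close> stand in for the chosen
  \<open>frechet_derivative\<close>; the smoothness inductions below go through it.\<close>

lemma Ck_on_SucI:
  assumes "open S" "\<And>x. x \<in> S \<Longrightarrow> (f has_derivative f' x) (at x)"
    and "\<And>v. Ck_on k S (\<lambda>x. f' x v)"
  shows "Ck_on (Suc k) S f"
proof -
  have "Ck_on k S (\<lambda>x. frechet_derivative f (at x) v)" for v
    using assms(3)[of v]
    by (rule iffD1[OF Ck_on_cong[OF assms(1)], rotated]) (simp add: frechet_derivativeI[OF assms(2)])
  then show ?thesis
    using assms(2) by (auto simp: differentiable_def)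
qed

lemma Ck_on_Suc_has_derivative:
  "Ck_on (Suc k) S f \<Longrightarrow> x \<in> S \<Longrightarrow> (f has_derivative frechet_derivative f (at x)) (at x)"
  by (simp add: frechet_derivative_works[symmetric])

text \<open>\<open>Ck_on\<close> asks for continuity at the top order only; at lower orders it comes
  from differentiability.\<close>

lemma Ck_on_SucD: "Ck_on (Suc k) S f \<Longrightarrow> Ck_on k S f"
proof (induction k arbitrary: f)
  case 0
  then show ?case
    by (auto intro!: continuous_at_imp_continuous_on differentiable_imp_continuous_within)
next
  case (Suc k)
  show ?case
    unfolding Ck_on.simps(2)[of k]
    using Suc.prems Suc.IH[of "\<lambda>x. frechet_derivative f (at x) _"] unfolding Ck_on.simps(2)[of "Suc k"]
    by blast
qed

lemma Ck_on_imp_continuous_on: "Ck_on k S f \<Longrightarrow> continuous_on S f"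
  by (induction k) (auto dest: Ck_on_SucD simp del: Ck_on.simps(2))

lemma Ck_on_const: "Ck_on k S (\<lambda>x. c)"
proof (induction k arbitrary: c)
  case (Suc k)
  have "frechet_derivative (\<lambda>x. c) (at x) v = 0" for x :: 'a and v
    by (simp add: frechet_derivativeI[OF has_derivative_const])
  then show ?case using Suc by simp
qed simp

lemma Ck_on_bounded_linear:
  assumes "bounded_linear f" shows "Ck_on k S f"
proof (cases k)
  case 0
  then show ?thesis by (simp add: assms linear_continuous_on)
next
  case (Suc m)
  have "frechet_derivative f (at x) = f" for x
    by (simp add: frechet_derivativeI[OF bounded_linear_imp_has_derivative[OF assms]])
  then show ?thesis
    using Suc bounded_linear_imp_differentiable[OF assms] by (simp add: Ck_on_const)
qed

lemma Ck_on_add: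
  assumes "open S" "Ck_on k S f" "Ck_on k S g"
  shows "Ck_on k S (\<lambda>x. f x + g x)"
  using assms(2,3)
proof (induction k arbitrary: f g)
  case (Suc k)
  show ?case
    by (rule Ck_on_SucI[OF assms(1) has_derivative_add
          [OF Suc.prems[THEN Ck_on_Suc_has_derivative]]])
      (use Suc in auto)
qed (simp add: continuous_on_add)

lemma Ck_on_sum:
  assumes "open S" "\<And>i. i \<in> I \<Longrightarrow> Ck_on k S (f i)"
  shows "Ck_on k S (\<lambda>x. \<Sum>i\<in>I. f i x)"
  using assms(2)
  by (induction I rule: infinite_finite_induct) (auto intro: Ck_on_const Ck_on_add[OF assms(1)])

text \<open>By the Leibniz rule a directional derivative is a sum of two products of maps of class
  \<open>k\<close>, to which the induction hypothesis applies.\<close>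

lemma (in bounded_bilinear) Ck_on:
  assumes "open S" "Ck_on k S f" "Ck_on k S g"
  shows "Ck_on k S (\<lambda>x. prod (f x) (g x))"
  using assms(2,3)
proof (induction k arbitrary: f g)
  case (Suc k)
  show ?case
  proof (rule Ck_on_SucI[OF assms(1) FDERIV[OF Suc.prems[THEN Ck_on_Suc_has_derivative]]])
    fix v
    show "Ck_on k S (\<lambda>x. prod (f x) (frechet_derivative g (at x) v)
        + prod (frechet_derivative f (at x) v) (g x))"
      using Suc Suc.prems[THEN Ck_on_SucD] by (intro Ck_on_add[OF assms(1)] Suc.IH) auto
  qed
qed (simp add: continuous_on)

lemmas Ck_on_mult = bounded_bilinear.Ck_on[OF bounded_bilinear_mult]
lemmas Ck_on_scaleR = bounded_bilinear.Ck_on[OF bounded_bilinear_scaleR]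

lemma Ck_on_compose:
  fixes f :: "'b::euclidean_space \<Rightarrow> 'c::real_normed_vector" and g :: "'a::real_normed_vector \<Rightarrow> 'b"
  assumes "open S" "Ck_on k T f" "Ck_on k S g" "g ` S \<subseteq> T"
  shows "Ck_on k S (\<lambda>x. f (g x))"
  using assms(2,3)
proof (induction k arbitrary: f)
  case 0
  then show ?case using assms(4) by (auto intro: continuous_on_compose2)
next
  case (Suc k)
  \<comment> \<open>The direction fed to the derivative of \<open>f\<close> varies with
    \<open>x\<close>, while \<open>Ck_on\<close> controls fixed directions; expanding it in the
    finite basis separates the two.\<close>
  let ?D = "\<lambda>x v. \<Sum>b\<in>Basis. (frechet_derivative g (at x) v \<bullet> b) *\<^sub>R frechet_derivative f (at (g x)) b"
  show ?case
  proof (rule Ck_on_SucI[OF assms(1)])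
    fix x assume x: "x \<in> S"
    have df: "(f has_derivative frechet_derivative f (at (g x))) (at (g x))"
      using Ck_on_Suc_has_derivative[OF Suc.prems(1)] x assms(4) by blast
    have dg: "(g has_derivative frechet_derivative g (at x)) (at x)"
      using Ck_on_Suc_has_derivative[OF Suc.prems(2) x] .
    have "frechet_derivative f (at (g x)) (frechet_derivative g (at x) v) = ?D x v" for v
      by (subst euclidean_representation[of "frechet_derivative g (at x) v", symmetric])
        (simp add: linear_sum[OF has_derivative_linear[OF df]] linear_scale[OF has_derivative_linear[OF df]]
          del: euclidean_representation)
    then show "((\<lambda>x. f (g x)) has_derivative ?D x) (at x)"
      using has_derivative_compose[OF dg df] by presburger
  next
    fix v
    show "Ck_on k S (\<lambda>x. ?D x v)"
    proof (intro Ck_on_sum Ck_on_scaleR assms(1))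
      fix b :: 'b
      show "Ck_on k S (\<lambda>x. frechet_derivative f (at (g x)) b)"
        using Suc.prems Ck_on_SucD by (intro Suc.IH) auto
      show "Ck_on k S (\<lambda>x. frechet_derivative g (at x) v \<bullet> b)"
        using Suc.prems
        by (intro bounded_bilinear.Ck_on[OF bounded_bilinear_inner assms(1)] Ck_on_const) auto
    qed
  qed
qed

text \<open>The exponent is arbitrary because differentiation stays in this family up to a constant
  factor.\<close>

lemma Ck_on_powr: "Ck_on k {0<..} (\<lambda>x::real. x powr e)"
proof (induction k arbitrary: e)
  case 0
  show ?case by (auto intro!: continuous_intros)
next
  case (Suc k)
  show ?case
  proof (rule Ck_on_SucI[where f' = "\<lambda>x v. v * (e * x powr (e - 1))"])
    fix x :: real assume "x \<in> {0<..}"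
    then show "((\<lambda>x. x powr e) has_derivative (\<lambda>v. v * (e * x powr (e - 1)))) (at x)"
      by (auto intro!: derivative_eq_intros simp: powr_diff)
  qed (auto intro!: Ck_on_mult Ck_on_const Suc)
qed

lemma Ck_on_exp: "Ck_on k UNIV (exp :: real \<Rightarrow> real)"
proof (induction k)
  case (Suc k)
  show ?case
    by (rule Ck_on_SucI[where f' = "\<lambda>x v. v * exp x"])
      (auto intro!: derivative_eq_intros Ck_on_mult Ck_on_const Suc)
qed (auto intro!: continuous_intros)

section \<open>Integrals along rays from the origin\<close>

lemma has_derivative_moment_integral:
  fixes h :: "'a::euclidean_space \<Rightarrow> real"
  assumes S: "open S" "convex S" "0 \<in> S" and h: "Ck_on (Suc 0) S h" and x: "x \<in> S"
  shows "((\<lambda>x. integral {0..1} (\<lambda>t. t ^ m * h (t *\<^sub>R x))) has_derivative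
     (\<lambda>v. integral {0..1} (\<lambda>t. t ^ Suc m * frechet_derivative h (at (t *\<^sub>R x)) v))) (at x)"
proof -
  have star: "t *\<^sub>R x \<in> S" if "x \<in> S" "t \<in> {0..1}" for x t
    using convexD_alt[OF S(2) S(3) that(1), of t] that(2) by simp
  note hd = Ck_on_Suc_has_derivative[OF h]
  have bl: "bounded_linear (frechet_derivative h (at y))" if "y \<in> S" for y
    using hd[OF that] by (rule has_derivative_bounded_linear)
  \<comment> \<open>The Leibniz rule wants the derivative in \<open>x\<close> as a continuous family
    of bounded operators. The factor \<open>t\<close> beyond \<open>t ^ m\<close> is the inner
    derivative of \<open>t *\<^sub>R x\<close>.\<close>
  define D where "D x t = Blinfun (\<lambda>v. t ^ Suc m * frechet_derivative h (at (t *\<^sub>R x)) v)" for x t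
  have D: "blinfun_apply (D x t) = (\<lambda>v. t ^ Suc m * frechet_derivative h (at (t *\<^sub>R x)) v)"
    if "x \<in> S" "t \<in> {0..1}" for x t
    unfolding D_def using bl[OF star[OF that]]
    by (intro bounded_linear_Blinfun_apply bounded_linear_const_mult)
  have ch: "continuous_on S h" by (rule Ck_on_imp_continuous_on[OF h])
  have cD: "continuous_on (S \<times> {0..1}) (\<lambda>(x, t). D x t)"
    unfolding split_beta
  \<comment> \<open>In finite dimension, continuity of an operator-valued map can be tested on basis
    vectors.\<close>
  proof (rule continuous_on_blinfun_componentwise)
    fix i :: 'a
    have "continuous_on S (\<lambda>y. frechet_derivative h (at y) i)" using h by simp
    then have "continuous_on (S \<times> {0..1}) (\<lambda>p. frechet_derivative h (at (snd p *\<^sub>R fst p)) i)"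
      by (rule continuous_on_compose2) (auto intro!: continuous_intros star)
    then have "continuous_on (S \<times> {0..1})
        (\<lambda>p. snd p ^ Suc m * frechet_derivative h (at (snd p *\<^sub>R fst p)) i)"
      by (intro continuous_intros)
    then show "continuous_on (S \<times> {0..1}) (\<lambda>p. blinfun_apply (D (fst p) (snd p)) i)"
      by (rule continuous_on_cong[THEN iffD1, rotated 2]) (auto simp: D)
  qed
  have int: "(\<lambda>t. t ^ m * h (t *\<^sub>R y)) integrable_on {0..1}" if "y \<in> S" for y
    by (intro integrable_continuous_real continuous_intros continuous_on_compose2[OF ch])
      (use star that in auto)
  have "((\<lambda>x. integral (cbox 0 1) (\<lambda>t. t ^ m * h (t *\<^sub>R x))) has_derivative
      blinfun_apply (integral (cbox 0 1) (D x))) (at x within S)"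
  proof (rule leibniz_rule[where fx = D])
    show "((\<lambda>x. t ^ m * h (t *\<^sub>R x)) has_derivative blinfun_apply (D y t)) (at y within S)"
      if "y \<in> S" "t \<in> cbox 0 1" for y t
    proof -
      have t: "t \<in> {0..1}" using that by simp
      have "((\<lambda>x. h (t *\<^sub>R x)) has_derivative (\<lambda>v. frechet_derivative h (at (t *\<^sub>R y)) (t *\<^sub>R v)))
          (at y within S)"
        by (rule has_derivative_compose[where f = "\<lambda>x. t *\<^sub>R x", OF _ hd[OF star[OF that(1) t]]])
          (auto intro!: derivative_eq_intros)
      from has_derivative_mult_right[OF this, of "t ^ m"] show ?thesis
        by (simp add: D[OF that(1) t] linear_scale[OF bounded_linear.linear[OF bl[OF star[OF that(1) t]]]]
            mult_ac)
    qed
  qed (use x S(2) int cD in auto)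
  then have 1: "((\<lambda>x. integral {0..1} (\<lambda>t. t ^ m * h (t *\<^sub>R x))) has_derivative
      blinfun_apply (integral {0..1} (D x))) (at x)"
    using at_within_open[OF x S(1)] by simp
  have "D x integrable_on {0..1}"
    by (intro integrable_continuous_real continuous_on_compose2[OF cD, where f = "\<lambda>t. (x, t)",
          unfolded case_prod_conv])
      (use x in \<open>auto intro!: continuous_intros\<close>)
  then have "blinfun_apply (integral {0..1} (D x)) v = integral {0..1} (\<lambda>t. blinfun_apply (D x t) v)" for v
    by (metis blinfun_apply_integral)
  moreover have "integral {0..1} (\<lambda>t. blinfun_apply (D x t) v)
      = integral {0..1} (\<lambda>t. t ^ Suc m * frechet_derivative h (at (t *\<^sub>R x)) v)" for v
    by (rule integral_cong) (simp add: D x)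
  ultimately show ?thesis using 1 by presburger
qed

text \<open>Differentiation turns the moment of order \<open>m\<close> of \<open>h\<close> into the
  moment of order \<open>Suc m\<close> of a directional derivative of \<open>h\<close>, hence an
  induction over all \<open>m\<close> and \<open>h\<close> at once.\<close>

lemma Ck_on_moment_integral:
  fixes h :: "'a::euclidean_space \<Rightarrow> real"
  assumes S: "open S" "convex S" "0 \<in> S" and "Ck_on k S h"
  shows "Ck_on k S (\<lambda>x. integral {0..1} (\<lambda>t. t ^ m * h (t *\<^sub>R x)))"
  using assms(4)
proof (induction k arbitrary: h m)
  case 0
  have star: "t *\<^sub>R x \<in> S" if "x \<in> S" "0 \<le> t" "t \<le> 1" for x t
    using convexD_alt[OF S(2) S(3) that(1), of t] that by simp
  have ch: "continuous_on S h" using 0 by simp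
  have "continuous_on S (\<lambda>x. integral (cbox 0 1) (\<lambda>t. t ^ m * h (t *\<^sub>R x)))"
    by (rule integral_continuous_on_param)
      (auto simp: split_beta intro!: continuous_intros continuous_on_compose2[OF ch] star)
  then show ?case by simp
next
  case (Suc k)
  have "Ck_on (Suc 0) S h"
    using Suc.prems by (auto dest: Ck_on_imp_continuous_on)
  from has_derivative_moment_integral[OF S this] show ?case
    by (rule Ck_on_SucI[OF S(1)]) (use Suc in \<open>auto simp del: power_Suc\<close>)
qed

lemma bounded_linear_imp_Ck_on_compose:
  fixes f :: "'b::euclidean_space \<Rightarrow> 'c::real_normed_vector" and g :: "'a::real_normed_vector \<Rightarrow> 'b"
  assumes "bounded_linear f" "open S" "Ck_on k S g"
  shows "Ck_on k S (\<lambda>x. f (g x))"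
  using Ck_on_compose[OF assms(2) Ck_on_bounded_linear[OF assms(1), of k UNIV] assms(3)] by simp

lemma Ck_on_Pair:
  fixes f :: "'a::real_normed_vector \<Rightarrow> 'b::euclidean_space" and g :: "'a \<Rightarrow> 'c::euclidean_space"
  assumes "open S" "Ck_on k S f" "Ck_on k S g"
  shows "Ck_on k S (\<lambda>x. (f x, g x))"
proof -
  have "bounded_linear (\<lambda>u::'b. (u, 0::'c))" "bounded_linear (\<lambda>u::'c. (0::'b, u))"
    by (auto intro!: bounded_linear_Pair bounded_linear_ident bounded_linear_zero)
  then have "Ck_on k S (\<lambda>x. (f x, 0) + (0, g x))"
    by (intro Ck_on_add[OF assms(1)])
      (rule bounded_linear_imp_Ck_on_compose[OF _ assms(1,2)]
        bounded_linear_imp_Ck_on_compose[OF _ assms(1,3)], assumption)+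
  then show ?thesis by simp
qed

section \<open>Radial solutions\<close>

text \<open>Derivatives at 0 are one-sided. The equation is imposed for \<open>r > 0\<close> only:
  at 0 the quotient \<open>Y' 0 / 0\<close> would be 0 in HOL, and \<open>Y''_0\<close> carries the
  limiting form of the equation.\<close>

locale calabi_profile =
  fixes n :: nat and a :: real and Y Y' Y'' :: "real \<Rightarrow> real"
  assumes n: "2 \<le> n" and a: "0 < a"
    and Y: "\<And>r. r \<in> {0..<a} \<Longrightarrow> (Y has_real_derivative Y' r) (at r within {0..<a})"
    and Y': "\<And>r. r \<in> {0..<a} \<Longrightarrow> (Y' has_real_derivative Y'' r) (at r within {0..<a})"
    and ode: "\<And>r. r \<in> {0<..<a} \<Longrightarrow> (Y' r / r) ^ (n - 1) * Y'' r = exp (Y r)"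
    and Y'_0: "Y' 0 = 0"
    and Y''_0: "Y'' 0 = exp (Y 0 / real n)"
    and Y'_blowup: "filterlim Y' at_top (at_left a)"
begin

section \<open>The profile on \<open>[0, a)\<close>: positivity, monotonicity and range of
  \<open>Y'\<close>\<close>

lemma deriv_interior:
  assumes "0 < r" "r < a"
  shows "(Y has_real_derivative Y' r) (at r)" "(Y' has_real_derivative Y'' r) (at r)"
proof -
  have "at r within {0..<a} = at r"
    by (rule at_within_interior) (use assms in \<open>auto simp: interior_atLeastLessThan\<close>)
  then show "(Y has_real_derivative Y' r) (at r)" "(Y' has_real_derivative Y'' r) (at r)"
    using Y[of r] Y'[of r] assms by auto
qed

lemma continuous_on_Y': "continuous_on {0..<a} Y'"
  using Y' DERIV_continuous continuous_on_eq_continuous_within by blast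

text \<open>\<open>Y'\<close> leaves 0 upwards because \<open>Y'' 0 > 0\<close>, and it cannot
  return: at a later zero the left side of the ODE would vanish while the exponential does
  not.\<close>

lemma Y'_pos:
  assumes "0 < r" "r < a" shows "0 < Y' r"
proof (rule ccontr)
  assume neg: "\<not> 0 < Y' r"
  have "0 < Y'' 0" by (simp add: Y''_0)
  with has_real_derivative_pos_inc_right[OF Y'[of 0]] a
  obtain d where d: "d > 0" "\<And>h. 0 < h \<Longrightarrow> h \<in> {0..<a} \<Longrightarrow> h < d \<Longrightarrow> Y' 0 < Y' h"
    by auto
  define h where "h = min r (d / 2)"
  have h: "0 < h" "h \<le> r" "h < d" using d(1) assms by (auto simp: h_def)
  have "0 < Y' h" using d(2)[of h] h assms Y'_0 by auto
  moreover have "continuous_on {h..r} Y'"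
    by (rule continuous_on_subset[OF continuous_on_Y']) (use h assms in auto)
  ultimately obtain c where "h \<le> c" "c \<le> r" "Y' c = 0"
    using IVT2'[of Y' r 0 h] neg h by fastforce
  with ode[of c] h assms n show False by (auto simp: power_0_left)
qed

text \<open>The value at 0 is the limit of the quotient, so that the ODE in the form
  \<open>slope_ode\<close> holds there too.\<close>

definition slope :: "real \<Rightarrow> real" where
  "slope r = (if r = 0 then Y'' 0 else Y' r / r)"

lemma slope_pos: "0 \<le> r \<Longrightarrow> r < a \<Longrightarrow> 0 < slope r"
  using Y'_pos[of r] by (auto simp: slope_def Y''_0)

lemma slope_mult: "slope r * r = Y' r"
  by (simp add: slope_def Y'_0)

text \<open>At the origin this is the \<open>n\<close>-th power of the initial condition for
  \<open>Y'' 0\<close>.\<close>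

lemma slope_ode:
  assumes "0 \<le> r" "r < a" shows "slope r ^ (n - 1) * Y'' r = exp (Y r)"
proof (cases "r = 0")
  case True
  have "slope r ^ (n - 1) * Y'' r = exp (Y 0 / real n) ^ Suc (n - 1)"
    by (simp add: True slope_def Y''_0)
  also have "\<dots> = exp (Y 0)"
    using n by (simp flip: exp_of_nat_mult del: power_Suc)
  finally show ?thesis using True by simp
qed (use ode[of r] assms in \<open>auto simp: slope_def\<close>)

lemma Y''_pos: "0 \<le> r \<Longrightarrow> r < a \<Longrightarrow> 0 < Y'' r"
  using slope_ode[of r] slope_pos[of r]
  by (metis exp_gt_zero zero_less_mult_pos zero_less_power)

lemma Y'_strict_mono:
  assumes "0 \<le> r" "r < s" "s < a" shows "Y' r < Y' s"
proof (rule DERIV_pos_imp_increasing_open[of r s Y'])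
  show "\<exists>y. DERIV Y' x :> y \<and> y > 0" if "r < x" "x < s" for x
    using deriv_interior(2)[of x] Y''_pos[of x] that assms by auto
  show "continuous_on {r..s} Y'"
    by (rule continuous_on_subset[OF continuous_on_Y']) (use assms in auto)
qed fact

text \<open>Intermediate value theorem between \<open>Y' 0 = 0\<close> and a point near
  \<open>a\<close> where the blow-up has carried \<open>Y'\<close> past \<open>t\<close>.\<close>

lemma Y'_surj:
  assumes "0 \<le> t" obtains r where "0 \<le> r" "r < a" "Y' r = t"
proof -
  have "eventually (\<lambda>x. t \<le> Y' x) (at_left a)"
    using Y'_blowup by (simp add: filterlim_at_top)
  moreover have "eventually (\<lambda>x. x \<in> {0<..<a}) (at_left a)"
    by (rule eventually_at_left_real[OF a])
  ultimately have "eventually (\<lambda>x. t \<le> Y' x \<and> x \<in> {0<..<a}) (at_left a)"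
    by (rule eventually_conj)
  then obtain s where s: "t \<le> Y' s" "0 < s" "s < a"
    using eventually_happens'[OF trivial_limit_at_left_real] by auto
  have "continuous_on {0..s} Y'"
    by (rule continuous_on_subset[OF continuous_on_Y']) (use s in auto)
  then show ?thesis
    using IVT'[of Y' 0 t s] s assms Y'_0 that by force
qed

text \<open>By the ODE, \<open>(Y' (t * r) / r) ^ n\<close> has \<open>t\<close>-derivative
  \<open>n * t ^ (n - 1) * exp (Y (t * r))\<close>; integrate over \<open>t\<close>. The right side
  has no division by \<open>r\<close>, so it can be differentiated across the origin.\<close>

lemma slope_power:
  assumes r: "0 \<le> r" "r < a"
  shows "slope r ^ n = real n * integral {0..1} (\<lambda>t. t ^ (n - 1) * exp (Y (t * r)))"
proof (cases "r = 0")
  case True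
  have "((\<lambda>t::real. t ^ (n - 1) * exp (Y 0)) has_integral 1 ^ n * exp (Y 0) / n - 0 ^ n * exp (Y 0) / n) {0..1}"
    by (rule fundamental_theorem_of_calculus)
      (use n in \<open>auto simp flip: has_real_derivative_iff_has_vector_derivative
         intro!: derivative_eq_intros\<close>)
  then have "real n * integral {0..1} (\<lambda>t. t ^ (n - 1) * exp (Y (t * r))) = exp (Y 0)"
    using n True by (simp add: integral_unique[of _ "exp (Y 0) / real n"] power_0_left
        del: integral_mult_left)
  moreover have "slope r ^ n = exp (Y 0)"
    using n by (simp add: True slope_def Y''_0 flip: exp_of_nat_mult)
  ultimately show ?thesis by simp
next
  case False
  then have r0: "0 < r" using r by simp
  have "((\<lambda>t. real n * (t ^ (n - 1) * exp (Y (t * r)))) has_integral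
      (Y' (1 * r) / r) ^ n - (Y' (0 * r) / r) ^ n) {0..1}"
  proof (rule fundamental_theorem_of_calculus, simp)
    fix t :: real assume t: "t \<in> {0..1}"
    then have tr: "0 \<le> t * r" "t * r < a"
      using r mult_left_le_one_le[of r t] by auto
    have "(\<lambda>t. t * r) ` {0..1} \<subseteq> {0..<a}"
      using r by (auto intro: order_le_less_trans[OF mult_left_le_one_le])
    then have "(Y' has_real_derivative Y'' (t * r)) (at (t * r) within (\<lambda>t. t * r) ` {0..1})"
      using Y'[of "t * r"] tr by (auto intro: DERIV_subset)
    moreover have "((\<lambda>t. t * r) has_real_derivative r) (at t within {0..1})"
      by (auto intro!: derivative_eq_intros)
    ultimately have "((\<lambda>t. Y' (t * r)) has_real_derivative Y'' (t * r) * r) (at t within {0..1})"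
      using DERIV_image_chain[of Y' _ "\<lambda>t. t * r"] by (simp add: o_def)
    from DERIV_power[OF DERIV_cdivide[OF this, of r], of n]
    have 1: "((\<lambda>t. (Y' (t * r) / r) ^ n) has_real_derivative
        real n * (Y'' (t * r) * (Y' (t * r) / r) ^ (n - 1))) (at t within {0..1})"
      using r0 by (simp add: mult_ac)
    \<comment> \<open>Trading \<open>Y' (t * r) / r\<close> for \<open>slope (t * r) * t\<close>
      lets the ODE apply down to \<open>t = 0\<close>.\<close>
    have "Y'' (t * r) * (Y' (t * r) / r) ^ (n - 1) = t ^ (n - 1) * exp (Y (t * r))"
    proof -
      have "Y' (t * r) / r = slope (t * r) * t"
        using slope_mult[of "t * r"] r0 by (simp add: field_simps)
      then show ?thesis
        using slope_ode[OF tr] by (simp add: power_mult_distrib mult_ac)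
    qed
    with 1 show "((\<lambda>t. (Y' (t * r) / r) ^ n) has_vector_derivative
        real n * (t ^ (n - 1) * exp (Y (t * r)))) (at t within {0..1})"
      by (simp add: has_real_derivative_iff_has_vector_derivative)
  qed
  then show ?thesis
    using n False by (simp add: slope_def Y'_0 power_0_left has_integral_iff)
qed

section \<open>Smoothness of the radial potential across the origin\<close>

lemma radial_has_derivative:
  fixes x :: "'b::euclidean_space"
  assumes "x \<in> ball 0 a"
  shows "((\<lambda>x. Y (norm x)) has_derivative (\<lambda>v. slope (norm x) * (x \<bullet> v))) (at x)"
proof (cases "x = 0")
  case True
  \<comment> \<open>The norm is not differentiable at 0, so the estimate for \<open>Y\<close> at 0
    is transferred directly; \<open>Y' 0 = 0\<close> removes the linear term.\<close>
  have "((\<lambda>x::'b. Y (norm x)) has_derivative (\<lambda>v. 0)) (at 0)"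
    unfolding has_derivative_at_alt
  proof (intro conjI allI impI)
    fix e :: real assume "0 < e"
    with Y[of 0] a Y'_0 obtain d where "d > 0"
      and d: "\<And>s. s \<in> {0..<a} \<Longrightarrow> norm (s - 0) < d \<Longrightarrow> norm (Y s - Y 0 - 0 * (s - 0)) \<le> e * norm (s - 0)"
      unfolding has_field_derivative_def has_derivative_within_alt by auto
    then show "\<exists>d>0. \<forall>y. norm (y - 0) < d \<longrightarrow>
        norm (Y (norm (y::'b)) - Y (norm (0::'b)) - 0) \<le> e * norm (y - 0)"
      using d a by (intro exI[of _ "min d a"]) auto
  qed simp
  then show ?thesis using True by simp
next
  case False
  with assms have "((\<lambda>x. Y (norm x)) has_derivative (\<lambda>v. Y' (norm x) * (v \<bullet> sgn x))) (at x)"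
    by (intro has_derivative_compose[OF has_derivative_norm[OF False]
          deriv_interior(1)[unfolded has_field_derivative_def]]) auto
  then show ?thesis
    using False by (simp add: slope_def sgn_div_norm inner_commute field_simps)
qed

text \<open>The \<open>n\<close>-th power of the slope is \<open>n\<close> times a moment integral
  of \<open>exp (Y (norm x))\<close>, and extracting the root is smooth as the slope is positive. No
  derivative is lost.\<close>

lemma Ck_on_slope_if:
  assumes "Ck_on k (ball 0 a) (\<lambda>x::'b::euclidean_space. Y (norm x))"
  shows "Ck_on k (ball 0 a) (\<lambda>x::'b. slope (norm x))"
proof -
  let ?I = "\<lambda>x::'b. real n * integral {0..1} (\<lambda>t. t ^ (n - 1) * exp (Y (norm (t *\<^sub>R x))))"
  have I: "?I x = slope (norm x) ^ n" if "x \<in> ball 0 a" for x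
  proof -
    have "integral {0..1} (\<lambda>t. t ^ (n - 1) * exp (Y (norm (t *\<^sub>R x))))
        = integral {0..1} (\<lambda>t. t ^ (n - 1) * exp (Y (t * norm x)))"
      by (rule integral_cong) simp
    then show ?thesis using slope_power[of "norm x"] that by simp
  qed
  have "Ck_on k (ball 0 a) (\<lambda>x::'b. exp (Y (norm x)))"
    by (rule Ck_on_compose[OF _ Ck_on_exp assms]) auto
  then have "Ck_on k (ball 0 a) ?I"
    using a by (intro Ck_on_mult Ck_on_const Ck_on_moment_integral) auto
  then have "Ck_on k (ball 0 a) (\<lambda>x. ?I x powr (1 / real n))"
    by (rule Ck_on_compose[OF open_ball Ck_on_powr]) (use I slope_pos in auto)
  then show ?thesis
  proof (rule Ck_on_cong[THEN iffD1, OF open_ball, rotated])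
    fix x :: 'b assume x: "x \<in> ball 0 a"
    then have "0 < slope (norm x)" by (simp add: slope_pos)
    then show "?I x powr (1 / real n) = slope (norm x)"
      unfolding I[OF x] using n by (simp add: powr_powr flip: powr_realpow)
  qed
qed

text \<open>Each round gains one derivative: class \<open>k\<close> of the potential gives class
  \<open>k\<close> of the slope, hence of the directional derivatives
  \<open>slope (norm x) * (x \<bullet> v)\<close>.\<close>

lemma Ck_on_radial: "Ck_on k (ball 0 a) (\<lambda>x::'b::euclidean_space. Y (norm x))"
proof (induction k)
  case 0
  show ?case
    by (auto intro!: continuous_at_imp_continuous_on has_derivative_continuous radial_has_derivative)
next
  case (Suc k)
  show ?case
    by (rule Ck_on_SucI[OF open_ball radial_has_derivative], assumption)
      (rule Ck_on_mult[OF open_ball Ck_on_slope_if[OF Suc] Ck_on_bounded_linear[OF bounded_linear_inner_left]])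
qed

lemmas Ck_on_slope = Ck_on_slope_if[OF Ck_on_radial]

text \<open>At \<open>r = 0\<close> the quotient is \<open>0\<close>, which is harmless: \<open>twist |x|\<close> only occurs multiplied
  by \<open>x\<close>.\<close>

definition twist :: "real \<Rightarrow> real" where
  "twist r = (Y'' r - slope r) / r\<^sup>2"

lemma slope_twist: "slope r + twist r * r\<^sup>2 = Y'' r"
  by (simp add: twist_def slope_def)

text \<open>Away from 0 this is the quotient rule; at 0 a derivative exists by
  \<open>Ck_on_slope\<close>, so it only has to be identified.\<close>

lemma slope_has_derivative:
  fixes x :: "'b::euclidean_space"
  assumes x: "x \<in> ball 0 a"
  shows "((\<lambda>x. slope (norm x)) has_derivative (\<lambda>v. twist (norm x) * (x \<bullet> v))) (at x)"
proof (cases "x = 0")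
  case True
  \<comment> \<open>The derivative of an even function is odd in the base point, so it vanishes at 0.\<close>
  obtain L where L: "((\<lambda>x::'b. slope (norm x)) has_derivative L) (at 0)"
    using Ck_on_Suc_has_derivative[OF Ck_on_slope[of "Suc 0"], of 0] a by auto
  have "((\<lambda>x::'b. slope (norm (- x))) has_derivative (\<lambda>v. L (- v))) (at 0)"
    by (rule has_derivative_compose[of uminus]) (use L in \<open>auto intro!: derivative_eq_intros\<close>)
  then have "((\<lambda>x::'b. slope (norm x)) has_derivative (\<lambda>v. L (- v))) (at 0)"
    by (simp only: norm_minus_cancel)
  from has_derivative_unique[OF L this] have "L v = L (- v)" for v
    by (rule fun_cong)
  moreover have "L (- v) = - L v" for v
    by (rule linear_neg[OF has_derivative_linear[OF L]])
  ultimately have "L v = 0" for v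
    by (metis equal_neg_zero)
  then have "L = (\<lambda>v. 0)" by blast
  then show ?thesis using L True by simp
next
  case False
  let ?r = "norm x"
  have "((\<lambda>r. Y' r / r) has_real_derivative (Y'' ?r * ?r - Y' ?r) / ?r\<^sup>2) (at ?r)"
    using deriv_interior(2)[of ?r] False x
    by (auto intro!: derivative_eq_intros simp: power2_eq_square)
  moreover have "(Y'' ?r * ?r - Y' ?r) / ?r\<^sup>2 = twist ?r * ?r"
    using False by (simp add: twist_def slope_def diff_divide_distrib left_diff_distrib power2_eq_square)
  ultimately have "((\<lambda>r. Y' r / r) has_real_derivative twist ?r * ?r) (at ?r)"
    by simp
  then have "(slope has_real_derivative twist ?r * ?r) (at ?r)"
    by (rule has_field_derivative_transform_within_open[where S = "{0<..}"])
      (use False in \<open>auto simp: slope_def\<close>)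
  from has_derivative_compose[OF has_derivative_norm[OF False] this[unfolded has_field_derivative_def]]
  show ?thesis
    using False by (simp add: sgn_div_norm inner_commute field_simps)
qed

section \<open>The gradient map, its Hessian and the inverse Hessian\<close>

definition gradient :: "'b::euclidean_space \<Rightarrow> 'b" where
  "gradient x = slope (norm x) *\<^sub>R x"

text \<open>For \<open>x \<noteq> 0\<close> and \<open>r = norm x\<close>, the eigenvalues are
  \<open>slope r\<close> orthogonally to \<open>x\<close> and, by \<open>slope_twist\<close>,
  \<open>Y'' r\<close> along \<open>x\<close>.\<close>

definition hessian :: "'b::euclidean_space \<Rightarrow> 'b \<Rightarrow> 'b" where
  "hessian x v = slope (norm x) *\<^sub>R v + (twist (norm x) * (x \<bullet> v)) *\<^sub>R x"

lemma gradient_has_derivative: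
  "x \<in> ball 0 a \<Longrightarrow> (gradient has_derivative hessian x) (at x)"
  unfolding gradient_def[abs_def] hessian_def[abs_def]
  by (rule has_derivative_eq_rhs[OF has_derivative_scaleR[OF slope_has_derivative has_derivative_ident]])
    auto

lemma Ck_on_gradient: "Ck_on k (ball 0 a) (gradient :: 'b::euclidean_space \<Rightarrow> 'b)"
  unfolding gradient_def[abs_def]
  by (intro Ck_on_scaleR Ck_on_slope Ck_on_bounded_linear bounded_linear_ident open_ball)

lemma norm_gradient: "x \<in> ball 0 a \<Longrightarrow> norm (gradient x) = Y' (norm x)"
  using slope_pos[of "norm x"] slope_mult[of "norm x"] by (simp add: gradient_def)

text \<open>The norm of the image determines \<open>norm x\<close> by monotonicity of
  \<open>Y'\<close>, and then the common positive slope cancels.\<close>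

lemma inj_on_gradient: "inj_on gradient (ball 0 a)"
proof (rule inj_onI)
  fix x y :: "'b::euclidean_space" assume xy: "x \<in> ball 0 a" "y \<in> ball 0 a" "gradient x = gradient y"
  then have "Y' (norm x) = Y' (norm y)" using norm_gradient by metis
  then have "norm x = norm y"
    using Y'_strict_mono[of "norm x" "norm y"] Y'_strict_mono[of "norm y" "norm x"] xy
    by (cases "norm x" "norm y" rule: linorder_cases) auto
  then show "x = y"
    using xy slope_pos[of "norm y"] by (simp add: gradient_def)
qed

lemma gradient_image: "gradient ` ball 0 a = (UNIV :: 'b::euclidean_space set)"
proof -
  have "\<exists>x\<in>ball 0 a. gradient x = u" for u :: 'b
  proof (cases "u = 0")
    case False
    obtain r where r: "0 \<le> r" "r < a" "Y' r = norm u" using Y'_surj[of "norm u"] by auto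
    with False Y'_0 have "r \<noteq> 0" by auto
    \<comment> \<open>The gradient is radial, so the preimage is sought on the ray of
      \<open>u\<close>, at the radius where \<open>Y'\<close> equals \<open>norm u\<close>.\<close>
    let ?x = "(r / norm u) *\<^sub>R u"
    have "norm ?x = r" using False r by simp
    moreover have "slope r * r = norm u" using slope_mult r by simp
    ultimately show ?thesis
      using False r by (intro bexI[of _ ?x]) (auto simp: gradient_def)
  qed (use a in \<open>auto simp: gradient_def intro!: bexI[of _ 0]\<close>)
  then show ?thesis by (metis UNIV_eq_I image_eqI)
qed

text \<open>The reciprocal of \<open>slope r * Y'' r\<close> is written through \<open>slope\<close>
  and \<open>exp (- Y r)\<close>, whose smoothness is known, rather than through
  \<open>Y''\<close>.\<close>

definition hessian_inv :: "'b::euclidean_space \<Rightarrow> 'b \<Rightarrow> 'b" where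
  "hessian_inv x v = slope (norm x) powr (-1) *\<^sub>R v
     - (slope (norm x) ^ (n - 2) * exp (- Y (norm x)) * (twist (norm x) * (x \<bullet> v))) *\<^sub>R x"

text \<open>The Sherman-Morrison formula for \<open>hessian x\<close>, a rank-one perturbation of \<open>slope r\<close> times the
  identity; the ODE turns the denominator \<open>slope r * Y'' r\<close> into \<open>exp (Y r) / slope r ^ (n - 2)\<close>.\<close>

lemma hessian_inv_hessian:
  assumes x: "x \<in> ball 0 a" shows "hessian_inv x (hessian x v) = v"
proof -
  let ?r = "norm x" let ?s = "slope ?r"
  have s: "0 < ?s" using slope_pos x by simp
  have "x \<bullet> hessian x v = (?s + twist ?r * ?r\<^sup>2) * (x \<bullet> v)"
    by (simp add: hessian_def inner_right_distrib power2_norm_eq_inner algebra_simps)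
  then have xh: "x \<bullet> hessian x v = Y'' ?r * (x \<bullet> v)" by (simp add: slope_twist)
  have "n - 1 = Suc (n - 2)" using n by simp
  then have "?s ^ (n - 2) * (?s * Y'' ?r) = exp (Y ?r)"
    using slope_ode[of ?r] x by (simp add: mult_ac)
  then have "?s ^ (n - 2) * exp (- Y ?r) * Y'' ?r = 1 / ?s"
    using s by (simp add: exp_minus field_simps)
  then have "?s ^ (n - 2) * exp (- Y ?r) * (twist ?r * (x \<bullet> hessian x v)) = 1 / ?s * (twist ?r * (x \<bullet> v))"
    unfolding xh by (metis mult.assoc mult.left_commute)
  then show ?thesis
    unfolding hessian_inv_def using s
    by (simp add: hessian_def scaleR_add_right powr_minus_divide)
qed

lemma bounded_linear_hessian_inv: "bounded_linear (hessian_inv x)"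
  unfolding hessian_inv_def[abs_def]
  by (intro bounded_linear_sub bounded_linear_scaleR_right bounded_linear_compose[OF bounded_linear_scaleR_left]
      bounded_linear_const_mult bounded_linear_inner_right)

lemma Ck_on_hessian_inv: "Ck_on k (ball 0 a) (\<lambda>x. hessian_inv x v)" for v :: "'b::euclidean_space"
proof -
  have pow: "Ck_on k (ball 0 a) (\<lambda>x::'b. slope (norm x) powr e)" for e
    by (rule Ck_on_compose[OF open_ball Ck_on_powr Ck_on_slope]) (auto simp: slope_pos)
  have 1: "Ck_on k (ball 0 a) (\<lambda>x::'b. slope (norm x) ^ (n - 2))"
    by (rule Ck_on_cong[THEN iffD1, OF open_ball _ pow[of "real (n - 2)"]])
      (simp add: slope_pos powr_realpow)
  have 2: "Ck_on k (ball 0 a) (\<lambda>x::'b. exp (- 1 * Y (norm x)))"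
    by (rule Ck_on_compose[OF open_ball Ck_on_exp Ck_on_mult[OF open_ball Ck_on_const Ck_on_radial]])
      auto
  \<comment> \<open>Smoothness is claimed for the product only, which is a directional derivative of
    the slope.\<close>
  have 3: "Ck_on k (ball 0 a) (\<lambda>x. twist (norm x) * (x \<bullet> v))"
  proof (rule Ck_on_cong[THEN iffD1, OF open_ball])
    show "Ck_on k (ball 0 a) (\<lambda>x. frechet_derivative (\<lambda>x. slope (norm x)) (at x) v)"
      using Ck_on_slope[of "Suc k", where 'b = 'b] by simp
  qed (simp add: frechet_derivativeI[OF slope_has_derivative])
  have "Ck_on k (ball 0 a) (\<lambda>x. slope (norm x) powr (-1) *\<^sub>R v
     + (- 1 * (slope (norm x) ^ (n - 2) * exp (- 1 * Y (norm x)) * (twist (norm x) * (x \<bullet> v)))) *\<^sub>R x)"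
    by (intro Ck_on_add Ck_on_scaleR Ck_on_mult[OF _ Ck_on_const] Ck_on_mult[OF _ Ck_on_mult[OF _ 1 2] 3]
        Ck_on_const pow open_ball Ck_on_bounded_linear[OF bounded_linear_ident])
  then show ?thesis by (simp add: hessian_inv_def)
qed

section \<open>The inverse of the gradient map and its smoothness\<close>

definition gradient_inv :: "'b::euclidean_space \<Rightarrow> 'b" where
  "gradient_inv = inv_into (ball 0 a) gradient"

lemma gradient_inv_mem: "gradient_inv u \<in> ball 0 a"
  unfolding gradient_inv_def by (rule inv_into_into) (simp add: gradient_image)

lemma gradient_gradient_inv: "gradient (gradient_inv u) = u"
  unfolding gradient_inv_def by (rule f_inv_into_f) (simp add: gradient_image)

lemma gradient_inv_gradient: "x \<in> ball 0 a \<Longrightarrow> gradient_inv (gradient x) = x"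
  unfolding gradient_inv_def by (rule inv_into_f_f[OF inj_on_gradient])

lemma continuous_on_gradient_inv: "continuous_on UNIV (gradient_inv :: 'b::euclidean_space \<Rightarrow> 'b)"
  using Further_Topology.continuous_on_inverse_open[OF open_ball
      Ck_on_imp_continuous_on[OF Ck_on_gradient[where 'b = 'b]] _ gradient_inv_gradient]
  by (simp add: gradient_image)

text \<open>The inverse rule rests on the continuity just proved and on \<open>hessian_inv\<close>
  inverting \<open>hessian\<close> from the left.\<close>

lemma gradient_inv_has_derivative:
  "(gradient_inv has_derivative hessian_inv (gradient_inv u)) (at u)"
proof (rule has_derivative_inverse_basic[where T = UNIV])
  show "(gradient has_derivative hessian (gradient_inv u)) (at (gradient_inv u))"
    by (rule gradient_has_derivative[OF gradient_inv_mem])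
  show "hessian_inv (gradient_inv u) \<circ> hessian (gradient_inv u) = id"
    by (simp add: fun_eq_iff hessian_inv_hessian[OF gradient_inv_mem])
  show "continuous (at u) gradient_inv"
    using continuous_on_gradient_inv by (auto simp: continuous_on_eq_continuous_at)
qed (auto simp: gradient_gradient_inv bounded_linear_hessian_inv)

text \<open>The derivative is \<open>hessian_inv\<close> composed with \<open>gradient_inv\<close>
  itself, so class \<open>k\<close> of the inverse yields class \<open>Suc k\<close>.\<close>

lemma Ck_on_gradient_inv: "Ck_on k UNIV (gradient_inv :: 'b::euclidean_space \<Rightarrow> 'b)"
proof (induction k)
  case 0
  show ?case by (simp add: continuous_on_gradient_inv)
next
  case (Suc k)
  show ?case
    by (rule Ck_on_SucI[OF open_UNIV gradient_inv_has_derivative])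
      (rule Ck_on_compose[OF open_UNIV Ck_on_hessian_inv Suc], use gradient_inv_mem in auto)
qed

end

section \<open>The tube domain\<close>

lemma add_conj_nth: "add_conj z $ j = 2 * Re (z $ j)"
  by (simp add: add_conj_def)

lemma bounded_linear_add_conj: "bounded_linear (add_conj :: complex^'n \<Rightarrow> real^'n)"
  unfolding linear_conv_bounded_linear[symmetric]
  by (rule linearI) (simp_all add: vec_eq_iff add_conj_nth algebra_simps)

definition im_vec :: "complex^'n \<Rightarrow> real^'n" where
  "im_vec z = (\<chi> j. Im (z $ j))"

lemma bounded_linear_im_vec: "bounded_linear (im_vec :: complex^'n \<Rightarrow> real^'n)"
  unfolding linear_conv_bounded_linear[symmetric]
  by (rule linearI) (simp_all add: vec_eq_iff im_vec_def)

text \<open>Inverse of the linear isomorphism \<open>z \<mapsto> (add_conj z, im_vec z)\<close>,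
  which turns the tube into the ball times the full space.\<close>

definition tube_point :: "(real^'n) \<times> (real^'n) \<Rightarrow> complex^'n" where
  "tube_point p = (\<chi> j. Complex (fst p $ j / 2) (snd p $ j))"

lemma bounded_linear_tube_point: "bounded_linear (tube_point :: _ \<Rightarrow> complex^'n)"
  unfolding linear_conv_bounded_linear[symmetric]
  by (rule linearI) (simp_all add: vec_eq_iff tube_point_def complex_eq_iff add_divide_distrib)

lemma add_conj_tube_point [simp]: "add_conj (tube_point (x, y)) = x"
  by (simp add: vec_eq_iff add_conj_nth tube_point_def)

lemma im_vec_tube_point [simp]: "im_vec (tube_point (x, y)) = y"
  by (simp add: vec_eq_iff im_vec_def tube_point_def)

lemma tube_point_add_conj_im_vec [simp]: "tube_point (add_conj z, im_vec z) = z"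
  by (simp add: vec_eq_iff add_conj_nth im_vec_def tube_point_def complex_eq_iff)

lemma tube_domain_eq: "tube_domain a = add_conj -` ball 0 a"
proof -
  have "tube_domain a = {tube_point (x, y) | x y. x \<in> ball 0 a}"
    by (simp add: tube_domain_def tube_point_def)
  also have "\<dots> = add_conj -` ball 0 a"
    by (force intro: tube_point_add_conj_im_vec[symmetric])
  finally show ?thesis .
qed

lemma open_tube_domain: "open (tube_domain a)"
  unfolding tube_domain_eq
  by (intro open_vimage open_ball linear_continuous_on bounded_linear_add_conj)

text \<open>Expand \<open>dz_j\<close> and \<open>d zbar_k\<close> into real and imaginary parts: by
  symmetry of \<open>M\<close> the \<open>dx dx\<close> and \<open>dy dy\<close> terms cancel, and
  the two kinds of mixed terms coincide, giving the factor \<open>-2 \<i>\<close> that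
  \<open>\<i> / 2\<close> turns into 1.\<close>

lemma symmetric_wedge_sum:
  fixes M :: "'n::finite \<Rightarrow> 'n \<Rightarrow> real" and u v :: "complex^'n"
  assumes sym: "\<And>j k. M j k = M k j"
  shows "(\<i> / 2) * (\<Sum>j\<in>UNIV. \<Sum>k\<in>UNIV. of_real (M j k) * wedge (\<lambda>w. w $ j) (\<lambda>w. cnj (w $ k)) u v)
    = of_real (\<Sum>k\<in>UNIV. \<Sum>j\<in>UNIV. M j k * (Re (u $ j) * Im (v $ k) - Re (v $ j) * Im (u $ k)))"
proof -
  define S where "S p q = (\<Sum>j\<in>UNIV. \<Sum>k\<in>UNIV. M j k * (p j * q k))" for p q :: "'n \<Rightarrow> real"
  have S_sym: "S p q = S q p" for p q
    unfolding S_def by (subst sum.swap) (simp add: sym[of _ "_::'n"] mult_ac)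
  let ?a = "\<lambda>j. Re (u $ j)" let ?b = "\<lambda>j. Im (u $ j)"
  let ?c = "\<lambda>j. Re (v $ j)" let ?d = "\<lambda>j. Im (v $ j)"
  let ?W = "\<Sum>j\<in>UNIV. \<Sum>k\<in>UNIV. of_real (M j k) * wedge (\<lambda>w. w $ j) (\<lambda>w. cnj (w $ k)) u v"
  have "Re ?W = S ?a ?c + S ?b ?d - S ?c ?a - S ?d ?b"
    by (simp add: S_def wedge_def sum.distrib sum_subtractf algebra_simps)
  moreover have "Im ?W = S ?b ?c - S ?a ?d - S ?d ?a + S ?c ?b"
    by (simp add: S_def wedge_def sum.distrib sum_subtractf algebra_simps)
  moreover have "(\<Sum>k\<in>UNIV. \<Sum>j\<in>UNIV. M j k * (?a j * ?d k - ?c j * ?b k)) = S ?a ?d - S ?c ?b"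
    by (subst sum.swap) (simp add: S_def sum_subtractf algebra_simps)
  ultimately show ?thesis
    using S_sym[of ?a ?c] S_sym[of ?b ?d] S_sym[of ?a ?d] S_sym[of ?b ?c]
    by (simp add: complex_eq_iff)
qed

text \<open>\<open>f\<close> is prescribed on the ball only; as the ball is open, this fixes its
  derivatives there.\<close>

locale calabi_potential = calabi_profile "CARD('n::finite)" a Y Y' Y''
  for a Y Y' Y'' and f :: "real^'n \<Rightarrow> real" +
  assumes f: "\<And>x. x \<in> ball 0 a \<Longrightarrow> f x = Y (norm x)"
begin

section \<open>The gradient map on the tube as a diffeomorphism\<close>

lemma f_has_derivative:
  assumes "x \<in> ball 0 a" shows "(f has_derivative (\<lambda>v. gradient x \<bullet> v)) (at x)"
proof -
  have "(f has_derivative (\<lambda>v. slope (norm x) * (x \<bullet> v))) (at x)"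
    by (rule has_derivative_transform_within_open[OF radial_has_derivative[OF assms] open_ball assms])
      (simp add: f)
  then show ?thesis by (simp add: gradient_def)
qed

lemma grad_eq: "x \<in> ball 0 a \<Longrightarrow> grad f x = gradient x"
  by (simp add: grad_def vec_eq_iff frechet_derivativeI[OF f_has_derivative] inner_axis)

lemma grad_map_eq:
  "z \<in> tube_domain a \<Longrightarrow> grad_map c f z = (c *\<^sub>R gradient (add_conj z), im_vec z)"
  by (simp add: grad_map_def tube_domain_eq grad_eq im_vec_def)

lemma grad_map_has_derivative:
  assumes z: "z \<in> tube_domain a"
  shows "(grad_map c f has_derivative
    (\<lambda>v. (c *\<^sub>R hessian (add_conj z) (add_conj v), im_vec v))) (at z)"
proof (rule has_derivative_transform_within_open[OF _ open_tube_domain z])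
  have "(gradient has_derivative hessian (add_conj z)) (at (add_conj z))"
    by (rule gradient_has_derivative) (use z in \<open>simp add: tube_domain_eq\<close>)
  from has_derivative_compose[OF bounded_linear_imp_has_derivative[OF bounded_linear_add_conj] this]
  show "((\<lambda>z. (c *\<^sub>R gradient (add_conj z), im_vec z)) has_derivative
      (\<lambda>v. (c *\<^sub>R hessian (add_conj z) (add_conj v), im_vec v))) (at z)"
    by (intro has_derivative_Pair has_derivative_scaleR_right
        bounded_linear_imp_has_derivative[OF bounded_linear_im_vec])
qed (simp add: grad_map_eq)

text \<open>Undoes the scaling by \<open>c\<close>, then the gradient, then the passage to real
  coordinates; smoothness of the inverse can be read off from this formula.\<close>

lemma grad_map_tube_point:
  assumes "c \<noteq> 0"
  defines "\<Psi> \<equiv> \<lambda>p :: (real^'n) \<times> (real^'n). tube_point (gradient_inv (inverse c *\<^sub>R fst p), snd p)"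
  shows "\<Psi> p \<in> tube_domain a" "grad_map c f (\<Psi> p) = p"
    and "z \<in> tube_domain a \<Longrightarrow> \<Psi> (grad_map c f z) = z"
proof -
  show mem: "\<Psi> p \<in> tube_domain a"
    using gradient_inv_mem by (simp add: \<Psi>_def tube_domain_eq)
  show "grad_map c f (\<Psi> p) = p"
    unfolding grad_map_eq[OF mem] using assms(1) by (simp add: \<Psi>_def gradient_gradient_inv)
  show "\<Psi> (grad_map c f z) = z" if "z \<in> tube_domain a"
    unfolding grad_map_eq[OF that] using assms(1) that
    by (simp add: \<Psi>_def gradient_inv_gradient tube_domain_eq)
qed

lemma diffeomorphism_grad_map:
  assumes c: "c \<noteq> 0"
  shows "diffeomorphism (tube_domain a) UNIV (grad_map c f)"
proof -
  let ?\<Psi> = "\<lambda>p :: (real^'n) \<times> (real^'n). tube_point (gradient_inv (inverse c *\<^sub>R fst p), snd p)"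
  note inv = grad_map_tube_point[OF c]
  have bij: "bij_betw (grad_map c f) (tube_domain a) UNIV"
    by (rule bij_betw_byWitness[where f' = ?\<Psi>]) (use inv in auto)
  have inv_eq: "inv_into (tube_domain a) (grad_map c f) p = ?\<Psi> p" for p
    by (rule inv_into_f_eq[OF bij_betw_imp_inj_on[OF bij]]) (rule inv)+
  have "Ck_on k (tube_domain a) (grad_map c f)" for k
  proof (rule Ck_on_cong[THEN iffD2, OF open_tube_domain grad_map_eq])
    have "Ck_on k (tube_domain a) (\<lambda>z. gradient (add_conj z))"
      by (rule Ck_on_compose[OF open_tube_domain Ck_on_gradient
            Ck_on_bounded_linear[OF bounded_linear_add_conj]]) (auto simp: tube_domain_eq)
    then show "Ck_on k (tube_domain a) (\<lambda>z. (c *\<^sub>R gradient (add_conj z), im_vec z))"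
      by (intro Ck_on_Pair Ck_on_scaleR[OF _ Ck_on_const] open_tube_domain
          Ck_on_bounded_linear[OF bounded_linear_im_vec])
  qed
  moreover have "Ck_on k UNIV ?\<Psi>" for k
  proof -
    have "bounded_linear (\<lambda>p::(real^'n) \<times> (real^'n). inverse c *\<^sub>R fst p)"
      by (intro bounded_linear_scaleR_right bounded_linear_compose[OF bounded_linear_scaleR_right]
          bounded_linear_fst)
    then have "Ck_on k UNIV (\<lambda>p::(real^'n) \<times> (real^'n). gradient_inv (inverse c *\<^sub>R fst p))"
      by (intro Ck_on_compose[OF open_UNIV Ck_on_gradient_inv] Ck_on_bounded_linear) auto
    then show ?thesis
      by (intro bounded_linear_imp_Ck_on_compose[OF bounded_linear_tube_point] Ck_on_Pair open_UNIV
          Ck_on_bounded_linear[OF bounded_linear_snd])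
  qed
  ultimately show ?thesis
    using bij open_tube_domain by (simp add: diffeomorphism_def smooth_on_def inv_eq[abs_def])
qed

section \<open>The Calabi form in real coordinates and the pullback\<close>

lemma d_zbar_potential:
  assumes z: "z \<in> tube_domain a"
  shows "d_zbar k (\<lambda>w. complex_of_real (f (add_conj w))) z = of_real (gradient (add_conj z) $ k)"
proof -
  have "(f has_derivative (\<lambda>v. gradient (add_conj z) \<bullet> v)) (at (add_conj z))"
    by (rule f_has_derivative) (use z in \<open>simp add: tube_domain_eq\<close>)
  from has_derivative_compose[OF bounded_linear_imp_has_derivative[OF bounded_linear_add_conj] this]
  have "((\<lambda>w. complex_of_real (f (add_conj w))) has_derivative
      (\<lambda>v. of_real (gradient (add_conj z) \<bullet> add_conj v))) (at z)"
    by (rule has_derivative_of_real)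
  \<comment> \<open>The potential is constant in imaginary directions, and the factor 2 from
    \<open>add_conj\<close> cancels the 1/2 in \<open>d_zbar\<close>.\<close>
  moreover have "add_conj (axis k 1) = 2 *\<^sub>R axis k 1" "add_conj (axis k \<i>) = 0"
    by (auto simp: vec_eq_iff add_conj_nth axis_def)
  ultimately show ?thesis
    by (simp add: d_zbar_def frechet_derivativeI inner_axis)
qed

lemma axis_nth: "axis j c $ k = (if k = j then c else 0)"
  by (simp add: axis_def)

definition hessian_entry :: "real^'n \<Rightarrow> 'n \<Rightarrow> 'n \<Rightarrow> real" where
  "hessian_entry x j k = hessian x (axis j 1) $ k"

lemma hessian_entry_sym: "hessian_entry x j k = hessian_entry x k j"
  by (simp add: hessian_entry_def hessian_def inner_axis axis_nth)

lemma hessian_nth: "hessian x v $ k = (\<Sum>j\<in>UNIV. hessian_entry x j k * v $ j)"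
proof -
  have "(\<Sum>j\<in>UNIV. hessian_entry x j k * v $ j)
      = slope (norm x) * (\<Sum>j\<in>UNIV. if j = k then v $ j else 0)
        + twist (norm x) * (\<Sum>j\<in>UNIV. x $ j * v $ j) * x $ k"
    unfolding sum_distrib_left sum_distrib_right sum.distrib[symmetric]
    by (rule sum.cong) (auto simp: hessian_entry_def hessian_def inner_axis axis_nth algebra_simps)
  then show ?thesis
    by (simp add: hessian_def inner_vec_def)
qed

lemma d_z_d_zbar_potential:
  assumes z: "z \<in> tube_domain a"
  shows "d_z j (d_zbar k (\<lambda>w. complex_of_real (f (add_conj w)))) z
    = of_real (hessian_entry (add_conj z) j k)"
proof -
  have "(gradient has_derivative hessian (add_conj z)) (at (add_conj z))"
    by (rule gradient_has_derivative) (use z in \<open>simp add: tube_domain_eq\<close>)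
  from has_derivative_compose[OF bounded_linear_imp_has_derivative[OF bounded_linear_add_conj] this]
  have "((\<lambda>w. complex_of_real (gradient (add_conj w) $ k)) has_derivative
      (\<lambda>v. of_real (hessian (add_conj z) (add_conj v) $ k))) (at z)"
    by (intro has_derivative_of_real bounded_linear.has_derivative[OF bounded_linear_vec_nth])
  \<comment> \<open>The formula for \<open>d_zbar\<close> is known on the tube, which is open, so it
    may be differentiated there.\<close>
  then have "(d_zbar k (\<lambda>w. complex_of_real (f (add_conj w))) has_derivative
      (\<lambda>v. of_real (hessian (add_conj z) (add_conj v) $ k))) (at z)"
    by (rule has_derivative_transform_within_open[OF _ open_tube_domain z])
      (simp add: d_zbar_potential)
  from frechet_derivativeI[OF this]
  have "frechet_derivative (d_zbar k (\<lambda>w. complex_of_real (f (add_conj w)))) (at z)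
      = (\<lambda>v. of_real (hessian (add_conj z) (add_conj v) $ k))" .
  moreover have "add_conj (axis j 1) = 2 *\<^sub>R axis j 1" "add_conj (axis j \<i>) = 0"
    by (auto simp: vec_eq_iff add_conj_nth axis_def)
  ultimately show ?thesis
    by (simp add: d_z_def hessian_entry_def) (simp add: hessian_def algebra_simps)
qed

text \<open>The derivative of the first component is \<open>c\<close> times the Hessian applied to
  \<open>add_conj v\<close>, that is, to twice the real part of \<open>v\<close>; hence the factor
  \<open>2 * c\<close> against the form computed by \<open>symmetric_wedge_sum\<close>.\<close>

lemma pullback_grad_map:
  assumes z: "z \<in> tube_domain a"
  shows "pullback (grad_map c f) std_symplectic z u v = of_real (2 * c) * calabi_form f z u v"
proof -
  let ?M = "hessian_entry (add_conj z)"
  let ?T = "\<Sum>k\<in>UNIV. \<Sum>j\<in>UNIV. ?M j k * (Re (u $ j) * Im (v $ k) - Re (v $ j) * Im (u $ k))"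
  have "calabi_form f z u v = of_real ?T"
    unfolding calabi_form_def ddbar_def d_z_d_zbar_potential[OF z]
    by (rule symmetric_wedge_sum[OF hessian_entry_sym])
  moreover have "pullback (grad_map c f) std_symplectic z u v = of_real (2 * c * ?T)"
    unfolding pullback_def frechet_derivativeI[OF grad_map_has_derivative[OF z]] std_symplectic_def
      wedge_def sum_distrib_left of_real_sum
    by (rule sum.cong)
      (simp_all add: hessian_nth add_conj_nth im_vec_def sum_distrib_left sum_distrib_right
        sum_subtractf algebra_simps)
  ultimately show ?thesis by simp
qed

lemma symplectomorphism_grad_map:
  assumes "c \<noteq> 0"
  shows "symplectomorphism (tube_domain a) (\<lambda>z u v. of_real (2 * c) * calabi_form f z u v)
    UNIV std_symplectic (grad_map c f)"
  using assms by (simp add: symplectomorphism_def diffeomorphism_grad_map pullback_grad_map)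

end

theorem theorem1:
  fixes a :: real and Y Y' Y'' :: "real \<Rightarrow> real" and f :: "real^'n \<Rightarrow> real"
  assumes "CARD('n) \<ge> 2"
    and "a > 0"
    and "\<And>r. r \<in> {0..<a} \<Longrightarrow> (Y has_real_derivative Y' r) (at r within {0..<a})"
    and "\<And>r. r \<in> {0..<a} \<Longrightarrow> (Y' has_real_derivative Y'' r) (at r within {0..<a})"
    and "\<And>r. r \<in> {0<..<a} \<Longrightarrow> (Y' r / r) ^ (CARD('n) - 1) * Y'' r = exp (Y r)"
    and "Y' 0 = 0"
    and "Y'' 0 = exp (Y 0 / real CARD('n))"
    and "filterlim Y' at_top (at_left a)"
    and "\<And>x. x \<in> ball 0 a \<Longrightarrow> f x = Y (norm x)"
  shows "symplectomorphism (tube_domain a) (calabi_form f) UNIV std_symplectic (grad_map (1/2) f)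
       \<and> symplectomorphism (tube_domain a) (\<lambda>z u v. 2 * calabi_form f z u v) UNIV std_symplectic
            (grad_map 1 f)"
proof -
  interpret calabi_potential a Y Y' Y'' f
    by unfold_locales (use assms in auto)
  show ?thesis
    \<comment> \<open>The factor \<open>2 * c\<close> is 1 for the first map and 2 for the
      second.\<close>
    using symplectomorphism_grad_map[of "1/2"] symplectomorphism_grad_map[of 1] by simp
qed

end
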